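(* Let $1\le\ell\le p$ be integers and let $f\in\mathcal E_p$ with zeros $-\lambda_k$ ($0\le\lambda_1\le\lambda_2\le\cdots$, counted with multiplicity). Let $0\le a_1\le\cdots\le a_n$ and $0\le b_1\le\cdots\le b_n$ be real numbers, put $\Delta_m=\sum_{j=1}^n(a_j^m-b_j^m)$ for $m\ge0$, and suppose that $\Delta_m=0$ for all $m$ with $0\le m\le\ell$. Let $W_f(x)=\prod_{k=1}^n f(x+a_k)\big/\prod_{k=1}^n f(x+b_k)$. Then for $x>0$ with $x\ge 2\max\{a_n,b_n\}$ we have $$\partial_x^{p-\ell}\log W_f(x)=\sum_{k\ge1}\frac1{(x+\lambda_k)^{p+1}}\sum_{m=\ell+1}^\infty\Delta_m\frac{C_{m,\ell}}{(x+\lambda_k)^{m-\ell-1}},$$ where $$C_{m,\ell}=(-1)^{p-\ell-1}(p-\ell-1)!\binom{\ell-p}{m}\ \text{ if }\ell<p,\qquad C_{m,\ell}=\frac{(-1)^{m+1}}{m}\ \text{ if }\ell=p,$$ and $$\sum_{m=\ell+1}^\infty\Delta_m\frac{C_{m,\ell}}{(x+\lambda_k)^{m-\ell-1}}$$ is bounded with a bound independent of $x$ and $k$.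
   Context: $\mathcal E_p$ denotes the class of entire functions $f$ that are real on the real axis, of genus $p$, have only real and non-positive zeros, and satisfy $f(x)>0$ for $x>0$. The zeros are written $-\lambda_k$, listed with multiplicity, and sums over $k$ run over all zeros. $\partial_x^{p-\ell}$ is the derivative of order $p-\ell$ ($\partial_x^0$ the identity). $\binom{\alpha}{m}=\alpha(\alpha-1)\cdots(\alpha-m+1)/m!$ is the generalised binomial coefficient, and $0^0=1$. *)

theory Defs
  imports "HOL-Complex_Analysis.Complex_Analysis" "HOL-Computational_Algebra.Polynomial"
    "HOL-Library.Extended_Nat"
begin

(* 1, 2, ..., N, or all positive integers if N is infinite: the index set of a finite or
   infinite list of zeros. *)
definition list_indices :: "enat \<Rightarrow> nat set" where
  "list_indices N = {k. 1 \<le> k \<and> enat k \<le> N}"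

(* f is the Hadamard product z^q * exp (g z) * (PROD k. E_h (z / c k)), where the c k are the
   nonzero zeros with multiplicity, E_h is the Weierstrass factor of order h, and h is the least
   exponent for which the sum of the |c k|^-(h+1) is finite. The genus is max (degree g) h.
   Indices outside the list contribute the factor 1 to the product, which has_prod takes over
   all naturals. *)
definition has_genus :: "(complex \<Rightarrow> complex) \<Rightarrow> nat \<Rightarrow> bool" where
  "has_genus f p \<longleftrightarrow>
     (\<exists>(q::nat) (g::complex poly) (h::nat) (N::enat) (c::nat \<Rightarrow> complex) (P::complex \<Rightarrow> complex).
        (\<forall>k\<in>list_indices N. c k \<noteq> 0) \<and>
        (\<lambda>k. 1 / norm (c k) ^ (h + 1)) summable_on list_indices N \<and>
        (\<forall>i<h. \<not> (\<lambda>k. 1 / norm (c k) ^ (i + 1)) summable_on list_indices N) \<and>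
        (\<forall>z. (\<lambda>k. if k \<in> list_indices N then weierstrass_factor h (z / c k) else 1) has_prod P z) \<and>
        (\<forall>z. f z = z ^ q * exp (poly g z) * P z) \<and>
        p = max (degree g) h)"

definition class_E :: "nat \<Rightarrow> (complex \<Rightarrow> complex) set" where
  "class_E p = {f. f holomorphic_on UNIV \<and> has_genus f p \<and>
     (\<forall>x::real. f (of_real x) \<in> \<real>) \<and>
     (\<forall>z. f z = 0 \<longrightarrow> z \<in> \<real> \<and> Re z \<le> 0) \<and>
     (\<forall>x::real. x > 0 \<longrightarrow> Re (f (of_real x)) > 0)}"

(* The zeros of f are exactly the numbers - lam k, each listed as often as its multiplicity;
   since zorder is positive at a zero, the set whose cardinality is taken is finite. *)
definition lists_zeros :: "(complex \<Rightarrow> complex) \<Rightarrow> enat \<Rightarrow> (nat \<Rightarrow> real) \<Rightarrow> bool" where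
  "lists_zeros f N lam \<longleftrightarrow>
     (\<forall>k\<in>list_indices N. 0 \<le> lam k \<and> f (- of_real (lam k)) = 0) \<and>
     mono_on (list_indices N) lam \<and>
     (\<forall>z. f z = 0 \<longrightarrow> int (card {k \<in> list_indices N. z = - of_real (lam k)}) = zorder f z)"

definition Delta :: "nat \<Rightarrow> (nat \<Rightarrow> real) \<Rightarrow> (nat \<Rightarrow> real) \<Rightarrow> nat \<Rightarrow> real" where
  "Delta n a b m = (\<Sum>j=1..n. a j ^ m - b j ^ m)"

definition W :: "(complex \<Rightarrow> complex) \<Rightarrow> nat \<Rightarrow> (nat \<Rightarrow> real) \<Rightarrow> (nat \<Rightarrow> real) \<Rightarrow> real \<Rightarrow> real" where
  "W f n a b x = (\<Prod>k=1..n. Re (f (of_real (x + a k)))) / (\<Prod>k=1..n. Re (f (of_real (x + b k))))"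

definition C :: "nat \<Rightarrow> nat \<Rightarrow> nat \<Rightarrow> real" where
  "C p m l = (if l < p
     then (-1) ^ (p - l - 1) * fact (p - l - 1) * ((real l - real p) gchoose m)
     else (-1) ^ (m + 1) / real m)"

definition inner_term :: "nat \<Rightarrow> nat \<Rightarrow> nat \<Rightarrow> (nat \<Rightarrow> real) \<Rightarrow> (nat \<Rightarrow> real) \<Rightarrow> real \<Rightarrow> nat \<Rightarrow> real" where
  "inner_term p l n a b t m = Delta n a b m * (C p m l / t ^ (m - l - 1))"

end

theory Submission
  imports Defs
begin

text \<open>
  For x > 0 the Hadamard product gives log f(x) as the sum of q log x, a polynomial of degree at
  most p, and one term log \<bar>E_h(- x / \<mu>)\<bar> for every negative zero - \<mu> of f. The last
  term is log (\<mu> + x) minus the Taylor polynomial of degree h of that function at 0, and h is at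
  most p. Now form the sum over j of the value at x + a_j minus the value at x + b_j. As the power
  sums of the a_j and the b_j agree up to exponent l, this operation sends each polynomial of degree
  at most l to 0; it commutes with differentiation, and the derivative of order p - l of a
  polynomial of degree at most p has degree at most l. Hence all polynomials disappear from the
  derivative of order p - l of log W_f, and what is left is the sum over all zeros - \<lambda>_k of
  the same combination of the derivative of order p - l of log at the points x + \<lambda>_k + a_j
  and x + \<lambda>_k + b_j. Expanding (x + \<lambda>_k + a_j)^(l-p), or the logarithm if l = p, in
  powers of a_j / (x + \<lambda>_k) turns that combination into the inner series of the claim, whose
  terms with m \<le> l vanish (shift_difference_expansion). The ratios a_j / (x + \<lambda>_k) are at
  most 1/2, which gives the uniform bound.

  Differentiating under the sum over k is legitimate because every derivative of a summand is, on
  bounded intervals, O(1 / \<mu>^(h+1)) (log_factor_bound): up to order h it is a Taylor remainder.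

  The zeros in the Hadamard product together with q copies of 0 are the same multiset as the
  - \<lambda>_k. This is read off from the order of vanishing of f at each point, which yields a
  bijection between the indices with \<lambda>_k \<noteq> 0 and those of the product, and shows that
  exactly q of the \<lambda>_k are 0 (zero_lists_match).
\<close>

section \<open>Derivatives of the logarithm\<close>

primrec ln_deriv :: "nat \<Rightarrow> real \<Rightarrow> real" where
  "ln_deriv 0 t = ln t"
| "ln_deriv (Suc r) t = (-1) ^ r * fact r / t ^ Suc r"

lemma has_field_derivative_ln_deriv:
  assumes "t > 0"
  shows "(ln_deriv r has_field_derivative ln_deriv (Suc r) t) (at t)"
proof (cases r)
  case 0
  have "ln_deriv 0 = ln" by auto
  then show ?thesis using DERIV_ln_divide[OF assms] 0 by simp
next
  case (Suc s)
  have "((\<lambda>t. t ^ Suc s) has_field_derivative real (Suc s) * t ^ s) (at t)"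
    using DERIV_pow[of "Suc s" t] by simp
  then have "((\<lambda>t. inverse (t ^ Suc s)) has_field_derivative
     - (inverse (t ^ Suc s) * (real (Suc s) * t ^ s) * inverse (t ^ Suc s))) (at t)"
    by (rule DERIV_inverse') (use assms in simp)
  then have "((\<lambda>t. (-1) ^ s * fact s * inverse (t ^ Suc s)) has_field_derivative
     (-1) ^ s * fact s * (- (inverse (t ^ Suc s) * (real (Suc s) * t ^ s) * inverse (t ^ Suc s)))) (at t)"
    by (rule DERIV_cmult)
  moreover have "(-1) ^ s * fact s * (- (inverse (t ^ Suc s) * (real (Suc s) * t ^ s) * inverse (t ^ Suc s)))
      = ln_deriv (Suc r) t"
    using assms Suc by (simp add: field_simps)
  moreover have "ln_deriv r = (\<lambda>t. (-1) ^ s * fact s * inverse (t ^ Suc s))"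
    using Suc by (auto simp: field_simps)
  ultimately show ?thesis by metis
qed

text \<open>
  The binomial series for l < p and the logarithmic series for l = p, in one formula. For l = p the
  coefficient C p 0 p is a division by zero and therefore 0, as it should be, since the logarithmic
  series starts at m = 1.
\<close>
lemma ln_deriv_expansion:
  assumes "l \<le> p" "\<bar>y\<bar> < t"
  shows "(\<lambda>m. C p m l * y ^ m / t ^ (m + (p - l)))
    sums (ln_deriv (p - l) (t + y) - (if l = p then ln t else 0))"
proof (cases "l = p")
  case True
  have t: "t > 0" using assms by linarith
  have "\<bar>y / t\<bar> < 1" using assms t by auto
  from Complex_Transcendental.ln_series'[OF this]
  have "(\<lambda>m. - ((- (y / t)) ^ m) / of_nat m) sums ln (1 + y / t)" .
  also have "ln (1 + y / t) = ln (t + y) - ln t"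
    using assms t ln_div[of "t + y" t] by (simp add: add_divide_distrib)
  also have "(\<lambda>m. - ((- (y / t)) ^ m) / of_nat m) = (\<lambda>m. C p m l * y ^ m / t ^ (m + (p - l)))"
    using True by (simp add: C_def fun_eq_iff power_divide power_minus[of "y / t"])
  finally show ?thesis using True by simp
next
  case False
  then obtain r where r: "p - l = Suc r" using assms by (cases "p - l") auto
  have t: "t > 0" using assms by linarith
  have "\<bar>y / t\<bar> < 1" using assms t by auto
  from Generalised_Binomial_Theorem.gen_binomial_real[OF this, of "real l - real p"]
  have "(\<lambda>m. ((real l - real p) gchoose m) * (y / t) ^ m) sums (1 + y / t) powr (real l - real p)" .
  then have *: "(\<lambda>m. ((-1) ^ r * fact r / t ^ Suc r) * (((real l - real p) gchoose m) * (y / t) ^ m))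
     sums (((-1) ^ r * fact r / t ^ Suc r) * (1 + y / t) powr (real l - real p))"
    by (rule sums_mult)
  have pos: "1 + y / t > 0" using assms t by (auto simp: field_simps)
  have "real l - real p = - real (Suc r)" using r assms by linarith
  then have "(1 + y / t) powr (real l - real p) = 1 / (1 + y / t) ^ Suc r"
    using pos by (metis powr_minus_divide powr_realpow)
  then have e: "((-1) ^ r * fact r / t ^ Suc r) * (1 + y / t) powr (real l - real p)
     = (-1) ^ r * fact r / (t * (1 + y / t)) ^ Suc r"
    by (simp add: power_mult_distrib)
  have "t * (1 + y / t) = t + y" using t by (simp add: field_simps)
  with e have e: "((-1) ^ r * fact r / t ^ Suc r) * (1 + y / t) powr (real l - real p)
     = ln_deriv (p - l) (t + y)" using r by simp
  have "((-1) ^ r * fact r / t ^ Suc r) * (((real l - real p) gchoose m) * (y / t) ^ m)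
     = C p m l * y ^ m / t ^ (m + (p - l))" for m
    using r False assms by (simp add: C_def power_divide power_add mult_ac)
  with * e show ?thesis using False by simp
qed

text \<open>
  The power series with coefficients C p m l converges at 3/4, hence absolutely at 1/2.
\<close>
lemma summable_norm_C:
  assumes "l \<le> p"
  shows "summable (\<lambda>m. \<bar>C p m l * (1 / 2) ^ m\<bar>)"
proof -
  have "summable (\<lambda>m. C p m l * (3 / 4) ^ m)"
    using ln_deriv_expansion[OF assms, of "3/4" 1] by (auto simp: sums_iff)
  from powser_insidea[OF this, of "1/2"] show ?thesis by simp
qed

section \<open>Differences over two families of shifts with equal power sums\<close>

text \<open>
  Taylor expansion at x expresses the difference through the power sums of exponent at most the
  degree.
\<close>
lemma shift_difference_poly:
  fixes Q :: "real poly"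
  assumes "degree Q \<le> l" and "\<And>m. m \<le> l \<Longrightarrow> Delta n a b m = 0"
  shows "(\<Sum>j=1..n. poly Q (x + a j) - poly Q (x + b j)) = 0"
proof -
  let ?R = "pcompose Q [:x, 1:]"
  have R: "poly Q (x + y) = (\<Sum>i\<le>degree ?R. coeff ?R i * y ^ i)" for y
  proof -
    have "poly Q (x + y) = poly ?R y" by (simp add: poly_pcompose)
    then show ?thesis by (simp add: poly_altdef)
  qed
  have "degree ?R \<le> l" using assms degree_pcompose_le[of Q "[:x, 1:]"] by simp
  moreover have "(\<Sum>j=1..n. poly Q (x + a j) - poly Q (x + b j))
      = (\<Sum>i\<le>degree ?R. coeff ?R i * Delta n a b i)"
    unfolding R Delta_def sum_distrib_left sum_subtractf[symmetric] right_diff_distrib[symmetric]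
    by (rule sum.swap)
  ultimately show ?thesis using assms(2) by simp
qed

text \<open>
  The inner series of the theorem at t = x + \<lambda>_k, together with a bound in which t does not
  occur. The factor t^(p+1) on the left compensates for the shift of exponent in
  m + (p - l) = (m - l - 1) + (p + 1).
\<close>
lemma shift_difference_expansion:
  assumes "l \<le> p" and Delta: "\<And>m. m \<le> l \<Longrightarrow> Delta n a b m = 0"
    and ab: "\<And>j. j \<in> {1..n} \<Longrightarrow> 0 \<le> a j \<and> a j \<le> M" "\<And>j. j \<in> {1..n} \<Longrightarrow> 0 \<le> b j \<and> b j \<le> M"
    and M: "0 \<le> M" and t: "0 < t" "2 * M \<le> t"
  shows "(inner_term p l n a b t has_sum
      t ^ (p + 1) * (\<Sum>j=1..n. ln_deriv (p - l) (t + a j) - ln_deriv (p - l) (t + b j))) {l+1..}"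
    and "\<bar>\<Sum>\<^sub>\<infinity>m\<in>{l+1..}. inner_term p l n a b t m\<bar>
      \<le> (\<Sum>m. 2 * real n * (2 * M) ^ (l + 1) * \<bar>C p m l * (1 / 2) ^ m\<bar>)"
proof -
  \<comment> \<open>The m-th term is at most 2 n \<bar>C p m l\<bar> M^m / t^(m-l-1) in absolute value. As M / t is at most 1/2,
     the factor M^m / t^(m-l-1) is at most M^(l+1) / 2^(m-l-1) = (2 M)^(l+1) / 2^m.\<close>
  let ?D = "\<Sum>j=1..n. ln_deriv (p - l) (t + a j) - ln_deriv (p - l) (t + b j)"
  let ?B = "\<lambda>m. 2 * real n * (2 * M) ^ (l + 1) * \<bar>C p m l * (1 / 2) ^ m\<bar>"
  let ?i = "\<lambda>m. if m \<in> {l+1..} then inner_term p l n a b t m else 0"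
  have Mt: "M < t" using M t by linarith
  have "(\<lambda>m. \<Sum>j=1..n. C p m l * a j ^ m / t ^ (m + (p - l)) - C p m l * b j ^ m / t ^ (m + (p - l)))
     sums (\<Sum>j=1..n. (ln_deriv (p - l) (t + a j) - (if l = p then ln t else 0))
                  - (ln_deriv (p - l) (t + b j) - (if l = p then ln t else 0)))"
    using ab Mt by (intro sums_sum sums_diff ln_deriv_expansion assms(1)) fastforce+
  then have "(\<lambda>m. \<Sum>j=1..n. C p m l * a j ^ m / t ^ (m + (p - l)) - C p m l * b j ^ m / t ^ (m + (p - l)))
     sums ?D" by simp
  from sums_mult[OF this, of "t ^ (p + 1)"]
  have *: "(\<lambda>m. t ^ (p + 1) * (\<Sum>j=1..n. C p m l * a j ^ m / t ^ (m + (p - l)) - C p m l * b j ^ m / t ^ (m + (p - l))))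
     sums (t ^ (p + 1) * ?D)" .
  have eq: "t ^ (p + 1) * (\<Sum>j=1..n. C p m l * a j ^ m / t ^ (m + (p - l)) - C p m l * b j ^ m / t ^ (m + (p - l)))
     = ?i m" for m
  proof -
    have "(\<Sum>j=1..n. C p m l * a j ^ m / t ^ (m + (p - l)) - C p m l * b j ^ m / t ^ (m + (p - l)))
      = (\<Sum>j=1..n. (a j ^ m - b j ^ m) * (C p m l / t ^ (m + (p - l))))"
      by (intro sum.cong) (auto simp: algebra_simps diff_divide_distrib)
    also have "\<dots> = Delta n a b m * (C p m l / t ^ (m + (p - l)))"
      unfolding Delta_def by (rule sum_distrib_right[symmetric])
    finally have 1: "(\<Sum>j=1..n. C p m l * a j ^ m / t ^ (m + (p - l)) - C p m l * b j ^ m / t ^ (m + (p - l)))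
      = Delta n a b m * (C p m l / t ^ (m + (p - l)))" .
    show ?thesis
    proof (cases "m \<le> l")
      case True
      then show ?thesis using 1 Delta by simp
    next
      case False
      then have "m + (p - l) = (m - l - 1) + (p + 1)" using assms by linarith
      then have "t ^ (m + (p - l)) = t ^ (m - l - 1) * t ^ (p + 1)" by (metis power_add)
      then show ?thesis using 1 False t by (simp add: inner_term_def)
    qed
  qed
  have bound: "\<bar>?i m\<bar> \<le> ?B m" for m
  proof (cases "m \<le> l")
    case True
    then show ?thesis using M by auto
  next
    case False
    then obtain k where k: "m = k + (l + 1)" by (metis Suc_eq_plus1 add.commute le_Suc_ex not_less_eq_eq)
    have "\<bar>Delta n a b m\<bar> \<le> (\<Sum>j=1..n. 2 * M ^ m)"
      unfolding Delta_def
    proof (rule order_trans[OF sum_abs sum_mono])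
      fix j assume j: "j \<in> {1..n}"
      have "0 \<le> a j ^ m" "a j ^ m \<le> M ^ m" "0 \<le> b j ^ m" "b j ^ m \<le> M ^ m"
        using ab[OF j] by (auto intro: power_mono)
      then show "\<bar>a j ^ m - b j ^ m\<bar> \<le> 2 * M ^ m" by linarith
    qed
    then have D: "\<bar>Delta n a b m\<bar> \<le> 2 * real n * M ^ m" by simp
    have "M ^ k * 2 ^ k \<le> t ^ k"
      using M t power_mono[of "M * 2" t k] by (simp add: power_mult_distrib)
    then have 2: "M ^ k / t ^ k \<le> (1 / 2) ^ k"
      using t by (simp add: field_simps)
    have "\<bar>?i m\<bar> = \<bar>Delta n a b m\<bar> * (\<bar>C p m l\<bar> / t ^ k)"
      using k t by (simp add: inner_term_def abs_mult)
    also have "\<dots> \<le> 2 * real n * M ^ m * (\<bar>C p m l\<bar> / t ^ k)"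
      using t by (intro mult_right_mono D) auto
    also have "\<dots> = 2 * real n * M ^ (l + 1) * \<bar>C p m l\<bar> * (M ^ k / t ^ k)"
      by (simp add: k power_add)
    also have "\<dots> \<le> 2 * real n * M ^ (l + 1) * \<bar>C p m l\<bar> * (1 / 2) ^ k"
      using M by (intro mult_left_mono 2) auto
    also have "\<dots> = ?B m"
      by (simp add: k power_add abs_mult power_mult_distrib field_simps)
    finally show ?thesis .
  qed
  have sB: "summable ?B" by (intro summable_mult summable_norm_C assms)
  have sn: "summable (\<lambda>m. norm (?i m))"
    by (rule summable_comparison_test'[OF sB, of 0]) (use bound in auto)
  have s: "?i sums (t ^ (p + 1) * ?D)" using * by (simp only: eq)
  from norm_summable_imp_has_sum[OF sn s]
  have "(?i has_sum (t ^ (p + 1) * ?D)) UNIV" .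
  also have "?this \<longleftrightarrow> (inner_term p l n a b t has_sum t ^ (p + 1) * ?D) {l+1..}"
    by (rule has_sum_cong_neutral) auto
  finally show hs: "(inner_term p l n a b t has_sum t ^ (p + 1) * ?D) {l+1..}" .
  have "(\<Sum>\<^sub>\<infinity>m\<in>{l+1..}. inner_term p l n a b t m) = suminf ?i"
    using infsumI[OF hs] s by (simp add: sums_iff)
  moreover have "\<bar>suminf ?i\<bar> \<le> suminf ?B"
    using summable_rabs[OF sn[unfolded real_norm_def]] suminf_le[OF bound sn[unfolded real_norm_def] sB]
    by linarith
  ultimately show "\<bar>\<Sum>\<^sub>\<infinity>m\<in>{l+1..}. inner_term p l n a b t m\<bar> \<le> suminf ?B" by simp
qed

section \<open>The logarithm of a Weierstrass factor with a negative zero\<close>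

text \<open>
  The Taylor polynomial of degree h at 0 of the function x \<mapsto> ln (\<mu> + x).
\<close>
definition taylor_ln :: "nat \<Rightarrow> real \<Rightarrow> real poly" where
  "taylor_ln h \<mu> = (\<Sum>i\<le>h. monom (ln_deriv i \<mu> / fact i) i)"

lemma coeff_taylor_ln: "coeff (taylor_ln h \<mu>) i = (if i \<le> h then ln_deriv i \<mu> / fact i else 0)"
  by (simp add: taylor_ln_def coeff_sum coeff_monom)

lemma degree_taylor_ln: "degree (taylor_ln h \<mu>) \<le> h"
  by (rule degree_le) (auto simp: coeff_taylor_ln)

text \<open>
  For r = 0 this is log \<bar>E_h(- x / \<mu>)\<bar>, because the exponent in E_h cancels exactly the
  terms of degree 1 to h of ln (1 + x / \<mu>); for larger r it is the r-th derivative.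
\<close>
definition log_factor :: "nat \<Rightarrow> nat \<Rightarrow> real \<Rightarrow> real \<Rightarrow> real" where
  "log_factor h r \<mu> x = ln_deriv r (\<mu> + x) - poly ((pderiv ^^ r) (taylor_ln h \<mu>)) x"

lemma norm_weierstrass_factor_negative_zero:
  assumes "\<mu> > 0" "x > 0"
  shows "norm (weierstrass_factor h (of_real x / - of_real \<mu>)) = exp (log_factor h 0 \<mu> x)"
proof -
  define y where "y = - x / \<mu>"
  have z: "of_real x / - of_real \<mu> = complex_of_real y" using assms by (simp add: y_def)
  have "(\<Sum>i=1..h. complex_of_real y ^ i / of_nat i) = of_real (\<Sum>i=1..h. y ^ i / real i)"
    by simp
  then have "norm (weierstrass_factor h (of_real y)) = norm (of_real (1 - y) * exp (complex_of_real (\<Sum>i=1..h. y ^ i / real i)))"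
    unfolding weierstrass_factor_def by simp
  also have "\<dots> = \<bar>1 - y\<bar> * exp (\<Sum>i=1..h. y ^ i / real i)"
    unfolding norm_mult norm_of_real norm_exp_eq_Re by simp
  also have "1 - y = (\<mu> + x) / \<mu>" using assms by (simp add: y_def field_simps)
  also have "\<bar>(\<mu> + x) / \<mu>\<bar> = exp (ln (\<mu> + x) - ln \<mu>)"
    using assms by (simp add: exp_diff)
  also have "exp (ln (\<mu> + x) - ln \<mu>) * exp (\<Sum>i=1..h. y ^ i / real i)
    = exp (ln (\<mu> + x) - ln \<mu> + (\<Sum>i=1..h. y ^ i / real i))" by (simp add: exp_add)
  also have "ln (\<mu> + x) - ln \<mu> + (\<Sum>i=1..h. y ^ i / real i) = log_factor h 0 \<mu> x"
  proof -
    have "poly (taylor_ln h \<mu>) x = (\<Sum>i\<le>h. ln_deriv i \<mu> / fact i * x ^ i)"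
      by (simp add: taylor_ln_def poly_sum poly_monom)
    also have "{..h} = insert 0 {1..h}" by auto
    also have "(\<Sum>i\<in>insert 0 {1..h}. ln_deriv i \<mu> / fact i * x ^ i)
       = ln \<mu> + (\<Sum>i=1..h. ln_deriv i \<mu> / fact i * x ^ i)" by simp
    also have "(\<Sum>i=1..h. ln_deriv i \<mu> / fact i * x ^ i) = (\<Sum>i=1..h. - (y ^ i / real i))"
    proof (rule sum.cong)
      fix i assume "i \<in> {1..h}"
      then obtain r where r: "i = Suc r" by (cases i) auto
      have "ln_deriv i \<mu> / fact i * x ^ i = (-1) ^ r * (x ^ i / \<mu> ^ i) / real i"
        unfolding r using assms by (simp add: fact_Suc divide_simps del: of_nat_Suc power_Suc)
      also have "\<dots> = - (y ^ i / real i)"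
        using r power_minus[of "x / \<mu>" i] by (simp add: y_def power_divide)
      finally show "ln_deriv i \<mu> / fact i * x ^ i = - (y ^ i / real i)" .
    qed simp
    finally show ?thesis by (simp add: log_factor_def sum_negf)
  qed
  finally show ?thesis using z by simp
qed

lemma has_field_derivative_log_factor:
  assumes "\<mu> + x > 0"
  shows "(log_factor h r \<mu> has_field_derivative log_factor h (Suc r) \<mu> x) (at x)"
proof -
  have "((\<lambda>x. ln_deriv r (\<mu> + x)) has_field_derivative ln_deriv (Suc r) (\<mu> + x)) (at x)"
    by (rule DERIV_at_within_shift[of "ln_deriv r" _ \<mu> x UNIV, simplified, THEN iffD1])
       (rule has_field_derivative_ln_deriv[OF assms, of r])
  then have "((\<lambda>x. ln_deriv r (\<mu> + x) - poly ((pderiv ^^ r) (taylor_ln h \<mu>)) x) has_field_derivative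
    ln_deriv (Suc r) (\<mu> + x) - poly (pderiv ((pderiv ^^ r) (taylor_ln h \<mu>))) x) (at x)"
    by (rule DERIV_diff[OF _ poly_DERIV])
  then show ?thesis by (simp add: log_factor_def[abs_def] del: ln_deriv.simps)
qed

lemma log_factor_at_0:
  assumes "r \<le> h"
  shows "log_factor h r \<mu> 0 = 0"
  using assms by (simp add: log_factor_def poly_0_coeff_0 coeff_higher_pderiv coeff_taylor_ln flip: pochhammer_fact)

lemma log_factor_beyond_degree:
  assumes "h < r"
  shows "log_factor h r \<mu> x = ln_deriv r (\<mu> + x)"
proof -
  have "(pderiv ^^ r) (taylor_ln h \<mu>) = 0"
    using assms by (intro poly_eqI) (simp add: coeff_higher_pderiv coeff_taylor_ln)
  then show ?thesis by (simp add: log_factor_def)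
qed

text \<open>
  For r > h only the derivative of ln is left, and it decays like 1 / \<mu>^r. For r \<le> h the
  function vanishes at 0, so the mean value theorem bounds it by R times the bound for order r + 1.
  Zeros with \<mu> < 1 are excluded because 1 / \<mu>^r need not be at most 1 / \<mu>^(h+1) for them;
  only finitely many zeros are affected.
\<close>
lemma log_factor_bound:
  assumes "R > 0"
  shows "\<exists>K\<ge>0. \<forall>\<mu>\<ge>1. \<forall>x\<in>{0..R}. \<bar>log_factor h r \<mu> x\<bar> \<le> K / \<mu> ^ (h + 1)"
\<comment> \<open>The induction descends from the orders r > h, all of which belong to the case 0.\<close>
proof (induction "h + 1 - r" arbitrary: r)
  case 0
  then obtain s where s: "r = Suc s" "h \<le> s" by (cases r) auto
  have "\<bar>log_factor h r \<mu> x\<bar> \<le> fact s / \<mu> ^ (h + 1)" if "\<mu> \<ge> 1" "x \<in> {0..R}" for \<mu> x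
  proof -
    have "\<mu> ^ (h + 1) \<le> \<mu> ^ Suc s" using that s by (intro power_increasing) auto
    also have "\<dots> \<le> (\<mu> + x) ^ Suc s" using that by (intro power_mono) auto
    finally have "\<mu> ^ (h + 1) \<le> (\<mu> + x) ^ Suc s" .
    then have "fact s / (\<mu> + x) ^ Suc s \<le> fact s / \<mu> ^ (h + 1)"
      using that by (intro divide_left_mono) auto
    then show ?thesis
      using that s by (simp add: log_factor_beyond_degree abs_mult)
  qed
  then show ?case by (intro exI[of _ "fact s"]) auto
next
  case (Suc q)
  then have "q = h + 1 - Suc r" "r \<le> h" by linarith+
  with Suc obtain K where K: "K \<ge> 0"
    "\<And>\<mu> x. \<mu> \<ge> 1 \<Longrightarrow> x \<in> {0..R} \<Longrightarrow> \<bar>log_factor h (Suc r) \<mu> x\<bar> \<le> K / \<mu> ^ (h + 1)"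
    by metis
  have "\<bar>log_factor h r \<mu> x\<bar> \<le> K * R / \<mu> ^ (h + 1)" if "\<mu> \<ge> 1" "x \<in> {0..R}" for \<mu> x
  proof -
    have "norm (log_factor h r \<mu> x - log_factor h r \<mu> 0) \<le> K / \<mu> ^ (h + 1) * norm (x - 0)"
    proof (rule field_differentiable_bound[of "{0..R}"])
      fix z assume z: "z \<in> {0..R}"
      show "(log_factor h r \<mu> has_field_derivative log_factor h (Suc r) \<mu> z) (at z within {0..R})"
        using that z by (intro has_field_derivative_at_within[OF has_field_derivative_log_factor]) auto
      show "norm (log_factor h (Suc r) \<mu> z) \<le> K / \<mu> ^ (h + 1)" using K(2)[OF that(1) z] by simp
    qed (use that in auto)
    also have "\<dots> \<le> K / \<mu> ^ (h + 1) * R" using that K by (intro mult_left_mono) auto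
    finally show ?thesis using log_factor_at_0[OF \<open>r \<le> h\<close>] by simp
  qed
  then show ?case using K assms by (intro exI[of _ "K * R"]) auto
qed

section \<open>Termwise differentiation\<close>

definition log_product :: "nat \<Rightarrow> nat set \<Rightarrow> (nat \<Rightarrow> real) \<Rightarrow> nat \<Rightarrow> real \<Rightarrow> real" where
  "log_product h J \<mu> r x = (\<Sum>k. if k \<in> J then log_factor h r (\<mu> k) x else 0)"

text \<open>
  The Weierstrass test with the bound of log_factor_bound, which covers all but finitely many terms
  because summability forces \<mu> k \<ge> 1 eventually.
\<close>
lemma
  assumes \<mu>: "\<And>k. k \<in> J \<Longrightarrow> \<mu> k > 0"
    and summ: "summable (\<lambda>k. if k \<in> J then 1 / \<mu> k ^ (h + 1) else 0)"
    and x: "x > 0"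
  shows summable_log_product: "summable (\<lambda>k. if k \<in> J then log_factor h r (\<mu> k) x else 0)"
    and has_field_derivative_log_product:
      "(log_product h J \<mu> r has_field_derivative log_product h J \<mu> (Suc r) x) (at x)"
proof -
  have "\<forall>\<^sub>F k in sequentially. (if k \<in> J then 1 / \<mu> k ^ (h + 1) else 0) < 1"
    by (rule order_tendstoD(2)[OF summable_LIMSEQ_zero[OF summ]]) auto
  then have ev: "\<forall>\<^sub>F k in sequentially. k \<in> J \<longrightarrow> 1 \<le> \<mu> k"
  proof eventually_elim
    case (elim k)
    show ?case
    proof
      assume k: "k \<in> J"
      show "1 \<le> \<mu> k"
      proof (rule ccontr)
        assume "\<not> 1 \<le> \<mu> k"
        then have "\<mu> k ^ (h + 1) \<le> 1" using \<mu>[OF k] by (intro power_le_one) auto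
        then show False using elim k \<mu>[OF k] by (simp add: field_simps del: power_Suc)
      qed
    qed
  qed
  let ?u = "\<lambda>r k x. if k \<in> J then log_factor h r (\<mu> k) x else 0"
  define R where "R = x + 1"
  have R: "R > 0" "x \<in> interior {0..R}" using x by (auto simp: R_def)
  have M: "\<exists>M. summable M \<and> (\<forall>\<^sub>F k in sequentially. \<forall>y\<in>{0..R}. norm (?u r k y) \<le> M k)" for r
  proof -
    from log_factor_bound[OF R(1), of h r] obtain K where K: "K \<ge> 0"
      "\<And>\<mu> x. \<mu> \<ge> 1 \<Longrightarrow> x \<in> {0..R} \<Longrightarrow> \<bar>log_factor h r \<mu> x\<bar> \<le> K / \<mu> ^ (h + 1)"
      by metis
    show ?thesis
    proof (intro exI conjI)
      show "summable (\<lambda>k. K * (if k \<in> J then 1 / \<mu> k ^ (h + 1) else 0))"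
        by (rule summable_mult[OF summ])
      from ev show "\<forall>\<^sub>F k in sequentially. \<forall>y\<in>{0..R}. norm (?u r k y)
          \<le> K * (if k \<in> J then 1 / \<mu> k ^ (h + 1) else 0)"
        by eventually_elim (use K in auto)
    qed
  qed
  have s: "summable (\<lambda>k. ?u r k x)" for r
  proof -
    from M obtain M where M: "summable M" "\<forall>\<^sub>F k in sequentially. \<forall>y\<in>{0..R}. norm (?u r k y) \<le> M k"
      by blast
    show ?thesis
    proof (rule summable_comparison_test_ev[OF _ M(1)])
      show "\<forall>\<^sub>F k in sequentially. norm (?u r k x) \<le> M k"
        using M(2) by eventually_elim (use x in \<open>simp add: R_def\<close>)
    qed
  qed
  then show "summable (\<lambda>k. ?u r k x)" .
  from M obtain M where M: "summable M" "\<forall>\<^sub>F k in sequentially. \<forall>y\<in>{0..R}. norm (?u (Suc r) k y) \<le> M k"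
    by blast
  show "(log_product h J \<mu> r has_field_derivative log_product h J \<mu> (Suc r) x) (at x)"
    unfolding log_product_def[abs_def]
  proof (rule has_field_derivative_series'(2)[of "{0..R}" _ _ x])
    fix k y assume "y \<in> {0..R}"
    then show "(?u r k has_field_derivative ?u (Suc r) k y) (at y within {0..R})"
      using \<mu>[of k] by (cases "k \<in> J") (auto intro!: has_field_derivative_at_within[OF has_field_derivative_log_factor])
  next
    show "uniformly_convergent_on {0..R} (\<lambda>n y. \<Sum>k<n. ?u (Suc r) k y)"
      by (rule Weierstrass_m_test'_ev[OF M(2,1)])
  qed (use R x s in \<open>auto simp: R_def\<close>)
qed

text \<open>
  To know all iterated derivatives on the half-line it is enough to exhibit a sequence of functions
  each of which is the derivative of its predecessor.
\<close>
lemma higher_deriv_eqI: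
  fixes F :: "real \<Rightarrow> real" and L :: "nat \<Rightarrow> real \<Rightarrow> real"
  assumes F: "\<And>x. x > 0 \<Longrightarrow> F x = L 0 x"
    and L: "\<And>r x. x > 0 \<Longrightarrow> (L r has_field_derivative L (Suc r) x) (at x)"
    and "x > 0"
  shows "(deriv ^^ r) F x = L r x"
    and "((deriv ^^ r) F has_field_derivative L (Suc r) x) (at x)"
proof -
  have step: "((deriv ^^ r) F has_field_derivative L (Suc r) x) (at x)"
    if "\<And>y. y > 0 \<Longrightarrow> (deriv ^^ r) F y = L r y" "x > 0" for r x
    by (rule has_field_derivative_transform_within_open[OF L[OF that(2)], of "{0<..}"])
       (use that in auto)
  have eq: "y > 0 \<Longrightarrow> (deriv ^^ r) F y = L r y" for y
  proof (induction r arbitrary: y)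
    case 0
    then show ?case by (simp add: F)
  next
    case (Suc r)
    from DERIV_imp_deriv[OF step[OF Suc.IH Suc.prems]] show ?case by simp
  qed
  show "(deriv ^^ r) F x = L r x" using eq assms by simp
  show "((deriv ^^ r) F has_field_derivative L (Suc r) x) (at x)" using step eq assms by simp
qed

section \<open>The zeros of a Hadamard product\<close>

lemma list_indices_cases:
  obtains "finite (list_indices N)" | "list_indices N = {1..}"
proof (cases N)
  case (enat M)
  then have "list_indices N \<subseteq> {..M}" by (auto simp: list_indices_def)
  then show ?thesis using that finite_subset by blast
next
  case infinity
  then have "list_indices N = {1..}" by (auto simp: list_indices_def)
  then show ?thesis using that by blast
qed

lemma zorder_weierstrass_factor_scaled:
  assumes "c \<noteq> 0"
  shows "zorder (\<lambda>w. weierstrass_factor h (w / c)) c = 1"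
proof -
  have "zorder (\<lambda>w. weierstrass_factor h (1 / c * w)) c = zorder (weierstrass_factor h) (1 / c * c)"
    using assms eventually_neq_at_within[of 1 "c / c" UNIV]
    by (intro zorder_scale analytic_intros analytic_on_imp_meromorphic_on) auto
  then show ?thesis using assms by simp
qed

text \<open>
  An infinite list of zeros, shifted to start at index 0, tends to infinity and so falls under the
  theory of Weierstrass products; a finite product is treated factor by factor.
\<close>
lemma canonical_product_zeros:
  assumes c: "\<And>k. k \<in> list_indices N \<Longrightarrow> c k \<noteq> 0"
    and summ: "(\<lambda>k. 1 / norm (c k) ^ (h + 1)) summable_on list_indices N"
    and P: "\<And>z. (\<lambda>k. if k \<in> list_indices N then weierstrass_factor h (z / c k) else 1) has_prod P z"
  shows "P analytic_on UNIV"
    and "finite {k \<in> list_indices N. c k = z}"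
    and "zorder P z = int (card {k \<in> list_indices N. c k = z})"
proof -
  let ?Z = "{k \<in> list_indices N. c k = z}"
  consider "finite (list_indices N)" | "list_indices N = {1..}" by (rule list_indices_cases)
  then have "P analytic_on UNIV \<and> finite ?Z \<and> zorder P z = int (card ?Z)"
  proof cases
    case 1
    let ?J = "list_indices N"
    have P_eq: "P = (\<lambda>z. \<Prod>k\<in>?J. weierstrass_factor h (z / c k))"
      using has_prod_unique2[OF P has_prod_If_finite_set[OF 1]] by auto
    have "P analytic_on UNIV"
      unfolding P_eq using c by (intro analytic_intros) auto
    moreover have "zorder P z = (\<Sum>k\<in>?J. zorder (\<lambda>z. weierstrass_factor h (z / c k)) z)"
      unfolding P_eq
    proof (rule zorder_prod_analytic)
      have "finite (c ` ?J)" using 1 by simp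
      then have "\<forall>\<^sub>F w in at z. w \<notin> c ` ?J"
        using islimpt_finite[of "c ` ?J" z] by (simp add: islimpt_iff_eventually)
      then show "\<forall>\<^sub>F w in at z. (\<Prod>k\<in>?J. weierstrass_factor h (w / c k)) \<noteq> 0"
        by eventually_elim (use 1 c in \<open>auto simp: field_simps\<close>)
    qed (use c in \<open>auto intro!: analytic_intros\<close>)
    moreover have "zorder (\<lambda>z. weierstrass_factor h (z / c k)) z = (if c k = z then 1 else 0)"
      if "k \<in> ?J" for k
    proof (cases "c k = z")
      case True
      then show ?thesis using zorder_weierstrass_factor_scaled[of "c k" h] c[OF that] by simp
    next
      case False
      have "zorder (\<lambda>z. weierstrass_factor h (z / c k)) z = 0"
        by (rule zorder_eq_0I) (use False c[OF that] in \<open>auto intro!: analytic_intros simp: field_simps\<close>)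
      then show ?thesis using False by simp
    qed
    then have "(\<Sum>k\<in>?J. zorder (\<lambda>z. weierstrass_factor h (z / c k)) z)
        = (\<Sum>k\<in>?J. if c k = z then 1 else 0)" by (intro sum.cong) auto
    moreover have "(\<Sum>k\<in>?J. if c k = z then 1 else 0) = int (card ?Z)"
      using 1 by (simp add: sum.If_cases Int_def)
    ultimately show ?thesis using 1 by simp
  next
    case 2
    have s: "summable (\<lambda>k. 1 / norm (c (Suc k)) ^ (h + 1))"
    proof -
      have "(\<lambda>k. if k \<in> {1..} then 1 / norm (c k) ^ (h + 1) else 0) summable_on UNIV
        \<longleftrightarrow> (\<lambda>k. 1 / norm (c k) ^ (h + 1)) summable_on {1..}"
        by (rule summable_on_cong_neutral) auto
      then have "summable (\<lambda>k. if k \<in> {1..} then 1 / norm (c k) ^ (h + 1) else 0)"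
        using summ 2 summable_on_imp_summable by auto
      from summable_ignore_initial_segment[OF this, of 1] show ?thesis by simp
    qed
    have nz: "c (Suc k) \<noteq> 0" for k using c[of "Suc k"] 2 by simp
    interpret weierstrass_product "\<lambda>k. c (Suc k)" "\<lambda>_. h"
    proof
      have "(\<lambda>k. 1 / norm (c (Suc k)) ^ (h + 1)) \<longlonglongrightarrow> 0" using s by (rule summable_LIMSEQ_zero)
      then have "(\<lambda>k. root (h + 1) (1 / norm (c (Suc k)) ^ (h + 1))) \<longlonglongrightarrow> root (h + 1) 0"
        by (rule tendsto_real_root)
      then have "(\<lambda>k. norm (1 / c (Suc k))) \<longlonglongrightarrow> 0"
        by (simp add: real_root_divide real_root_power_cancel norm_divide del: power_Suc)
      then have "(\<lambda>k. inverse (c (Suc k))) \<longlonglongrightarrow> 0"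
        by (simp only: tendsto_norm_zero_iff inverse_eq_divide)
      then have "filterlim (\<lambda>k. inverse (inverse (c (Suc k)))) at_infinity sequentially"
        using nz by (intro filterlim_compose[OF filterlim_inverse_at_infinity]) (auto simp: filterlim_at)
      then show "filterlim (\<lambda>k. c (Suc k)) at_infinity sequentially" by simp
    next
      fix r :: real assume "r > 0"
      have "summable (\<lambda>k. r ^ (h + 1) * (1 / norm (c (Suc k)) ^ (h + 1)))"
        by (rule summable_mult[OF s])
      then show "summable (\<lambda>k. (r / norm (c (Suc k))) ^ Suc h)" by (simp add: power_divide)
    qed (rule nz)
    have P_eq: "P = f"
    proof
      fix w
      let ?g = "\<lambda>k. if k \<in> list_indices N then weierstrass_factor h (w / c k) else 1"
      have "?g has_prod (f w * ?g 0)"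
        by (subst has_prod_Suc_iff[symmetric]) (use has_prod[of w] 2 in auto)
      then show "P w = f w" using has_prod_unique2[OF P[of w]] 2 by simp
    qed
    have im: "?Z = Suc ` ((\<lambda>k. c (Suc k)) -` {z})"
      using 2 by (auto simp: image_iff Bex_def) (metis Suc_le_D)
    have "card ?Z = card ((\<lambda>k. c (Suc k)) -` {z})"
      unfolding im by (rule card_image) simp
    moreover have "finite ?Z" unfolding im using finite_occs_a by blast
    ultimately show ?thesis using zorder[of z] analytic P_eq by simp
  qed
  then show "P analytic_on UNIV" "finite ?Z" "zorder P z = int (card ?Z)" by auto
qed

text \<open>
  At every point z both lists account for the order of f at z, where the factor z^q contributes q
  at the origin.
\<close>
lemma zero_lists_match:
  fixes f :: "complex \<Rightarrow> complex" and g :: "complex poly"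
  assumes c: "\<And>k. k \<in> list_indices N' \<Longrightarrow> c k \<noteq> 0"
    and summ: "(\<lambda>k. 1 / norm (c k) ^ (h + 1)) summable_on list_indices N'"
    and P: "\<And>z. (\<lambda>k. if k \<in> list_indices N' then weierstrass_factor h (z / c k) else 1) has_prod P z"
    and f: "\<And>z. f z = z ^ q * exp (poly g z) * P z"
    and nz: "f \<beta> \<noteq> 0"
    and lam: "lists_zeros f N lam"
  shows "finite {k \<in> list_indices N. lam k = 0}"
    and "card {k \<in> list_indices N. lam k = 0} = q"
    and "\<exists>s. bij_betw s (list_indices N') {k \<in> list_indices N. lam k \<noteq> 0} \<and>
           (\<forall>k\<in>list_indices N'. c k = - of_real (lam (s k)))"
proof -
  note cp = canonical_product_zeros[OF c summ P]
  let ?Z = "\<lambda>z. {k \<in> list_indices N'. c k = z}"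
  let ?L = "\<lambda>z. {k \<in> list_indices N. z = - complex_of_real (lam k)}"
  have f_eq: "f = (\<lambda>z. z ^ q * exp (poly g z) * P z)" using f by auto
  have holo: "f holomorphic_on UNIV" unfolding f_eq
    by (rule holomorphic_on_mult[OF _ analytic_imp_holomorphic[OF cp(1)]])
       (auto intro!: holomorphic_intros)
  have ev: "\<forall>\<^sub>F w in at z. f w \<noteq> 0" for z
    using non_zero_neighbour_alt[OF holo open_UNIV connected_UNIV UNIV_I UNIV_I nz, of z] by simp
  have an_P: "P analytic_on {z}" for z using cp(1) analytic_on_subset by blast
  have an_g: "poly g analytic_on A" for A
  proof -
    have "poly g holomorphic_on UNIV"
      using poly_holomorphic_on[OF holomorphic_on_ident, of g UNIV] by simp
    then have "poly g analytic_on UNIV" by (simp add: analytic_on_open)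
    then show ?thesis using analytic_on_subset by blast
  qed
  have zero_f: "f z = 0 \<longleftrightarrow> z = 0 \<and> q > 0 \<or> ?Z z \<noteq> {}" for z
  proof -
    have "P z = 0 \<longleftrightarrow> ?Z z \<noteq> {}"
      using has_prod_eq_0_iff[OF P[of z]] c by (auto simp: image_iff split: if_splits)
    then show ?thesis by (auto simp: f)
  qed
  have zorder_f: "zorder f z = int (if z = 0 then q else 0) + int (card (?Z z))" for z
  proof -
    have "zorder f z = zorder (\<lambda>w. w ^ q * exp (poly g w)) z + zorder P z"
      unfolding f_eq
      by (rule zorder_times_analytic) (use an_P an_g ev[of z] in \<open>auto intro!: analytic_intros simp: f\<close>)
    also have "zorder (\<lambda>w. w ^ q * exp (poly g w)) z = int (if z = 0 then q else 0)"
    proof (cases "z = 0")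
      case True
      show ?thesis
        by (rule zorder_eqI[of UNIV _ "\<lambda>w. exp (poly g w)"]) (auto intro!: holomorphic_intros simp: True)
    next
      case False
      show ?thesis
        using False by (auto intro!: zorder_eq_0I analytic_intros an_g)
    qed
    finally show ?thesis using cp(3) by simp
  qed
  \<comment> \<open>If f z = 0, finiteness of the fibre of lam follows from its cardinality being positive;
     if f z \<noteq> 0, both fibres are empty.\<close>
  have fiber: "finite (?L z) \<and> card (?L z) = (if z = 0 then q else 0) + card (?Z z)" for z
  proof (cases "f z = 0")
    case True
    then have "int (card (?L z)) = zorder f z" using lam by (simp add: lists_zeros_def)
    with zorder_f[of z] have e: "card (?L z) = (if z = 0 then q else 0) + card (?Z z)" by simp
    have "card (?L z) > 0"
      using True zero_f[of z] cp(2)[of z] unfolding e by (auto simp: card_gt_0_iff)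
    then show ?thesis using e card_ge_0_finite by blast
  next
    case False
    then have "?L z = {}" using lam by (auto simp: lists_zeros_def)
    then show ?thesis using False zero_f[of z] by (auto simp only: card.empty finite.emptyI split: if_splits)
  qed
  have Z0: "?Z 0 = {}" using c by auto
  have L0: "?L 0 = {k \<in> list_indices N. lam k = 0}" by auto
  show "finite {k \<in> list_indices N. lam k = 0}" "card {k \<in> list_indices N. lam k = 0} = q"
    using fiber[of 0] Z0 L0 by simp_all
  \<comment> \<open>Glue bijections between the fibres over the individual zeros.\<close>
  have "\<exists>s. bij_betw s (?Z z) (?L z)" if "z \<noteq> 0" for z
    using fiber[of z] cp(2)[of z] that by (intro finite_same_card_bij) auto
  then obtain s where s: "\<And>z. z \<noteq> 0 \<Longrightarrow> bij_betw (s z) (?Z z) (?L z)" by metis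
  define t where "t k = s (c k) k" for k
  have t: "t k \<in> list_indices N \<and> c k = - of_real (lam (t k))" if "k \<in> list_indices N'" for k
    using bij_betwE[OF s[OF c[OF that]]] that by (auto simp: t_def)
  have "bij_betw t (list_indices N') {k \<in> list_indices N. lam k \<noteq> 0}"
    unfolding bij_betw_def
  proof
    show "inj_on t (list_indices N')"
    proof (rule inj_onI)
      fix j k assume jk: "j \<in> list_indices N'" "k \<in> list_indices N'" "t j = t k"
      then have "c j = c k" using t by metis
      moreover have "inj_on (s (c k)) (?Z (c k))" using s[OF c[OF jk(2)]] by (rule bij_betw_imp_inj_on)
      ultimately show "j = k" using jk unfolding t_def inj_on_def by simp
    qed
    show "t ` list_indices N' = {k \<in> list_indices N. lam k \<noteq> 0}"
    proof (intro equalityI subsetI)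
      fix y assume "y \<in> t ` list_indices N'"
      then show "y \<in> {k \<in> list_indices N. lam k \<noteq> 0}" using t c by force
    next
      fix y assume y: "y \<in> {k \<in> list_indices N. lam k \<noteq> 0}"
      let ?z = "- complex_of_real (lam y)"
      have "y \<in> s ?z ` ?Z ?z" using y s[of ?z] by (simp add: bij_betw_def)
      then obtain k where "k \<in> list_indices N'" "y = t k" by (auto simp: t_def)
      then show "y \<in> t ` list_indices N'" by blast
    qed
  qed
  then show "\<exists>s. bij_betw s (list_indices N') {k \<in> list_indices N. lam k \<noteq> 0} \<and>
           (\<forall>k\<in>list_indices N'. c k = - of_real (lam (s k)))"
    using t by blast
qed

section \<open>The logarithm of the quotient of shifts\<close>

lemma poly_map_poly_Re: "poly (map_poly Re g) x = Re (poly g (of_real x))"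
  by (induction g) (simp_all add: map_poly_pCons)

text \<open>
  As f(x) is positive it equals its absolute value, which is the product of the absolute values of
  the factors. This turns g into Re g and P into its norm, whatever the phases of exp (g x) and P.
\<close>
lemma ln_hadamard_product:
  assumes f: "f (of_real x) = of_real x ^ q * exp (poly g (of_real x)) * P"
    and real: "f (of_real x) \<in> \<real>" "Re (f (of_real x)) > 0" and x: "x > 0"
    and c: "\<And>k. k \<in> J \<Longrightarrow> c k = - of_real (\<mu> k)" "\<And>k. k \<in> J \<Longrightarrow> \<mu> k > 0"
    and P: "(\<lambda>k. if k \<in> J then weierstrass_factor h (of_real x / c k) else 1) has_prod P"
  shows "ln (Re (f (of_real x))) = real q * ln x + poly (map_poly Re g) x + log_product h J \<mu> 0 x"
proof -
  let ?u = "\<lambda>k. if k \<in> J then log_factor h 0 (\<mu> k) x else 0"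
  have "norm (if k \<in> J then weierstrass_factor h (of_real x / c k) else 1) = exp (?u k)" for k
    using norm_weierstrass_factor_negative_zero[OF c(2) x] c(1) by simp
  with has_prod_norm[OF P] have "(\<lambda>k. exp (?u k)) has_prod norm P" by simp
  from has_prod_imp_sums_ln_real'[OF this] have lnP: "ln (norm P) = log_product h J \<mu> 0 x"
    unfolding log_product_def by (simp add: sums_iff)
  have "Re (f (of_real x)) = norm (f (of_real x))"
    using real by (auto elim!: Reals_cases)
  also have "\<dots> = x ^ q * exp (Re (poly g (of_real x))) * norm P"
    using x by (simp add: f norm_mult norm_power norm_exp_eq_Re)
  finally have e: "Re (f (of_real x)) = x ^ q * exp (Re (poly g (of_real x))) * norm P" .
  with real have "norm P > 0" by (auto simp: f)
  then show ?thesis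
    using x by (simp add: e ln_mult ln_realpow lnP poly_map_poly_Re)
qed

theorem lemma2p4:
  fixes l p n :: nat and f :: "complex \<Rightarrow> complex"
    and N :: enat and lam a b :: "nat \<Rightarrow> real"
  assumes "1 \<le> l" and "l \<le> p"
    and "f \<in> class_E p"
    and "lists_zeros f N lam"
    and "1 \<le> n"
    and "0 \<le> a 1" and "mono_on {1..n} a"
    and "0 \<le> b 1" and "mono_on {1..n} b"
    and "\<And>m. m \<le> l \<Longrightarrow> Delta n a b m = 0"
  defines "F \<equiv> (\<lambda>x. ln (W f n a b x))"
    and "X \<equiv> {x::real. 0 < x \<and> 2 * max (a n) (b n) \<le> x}"
    and "S \<equiv> (\<lambda>x k. \<Sum>\<^sub>\<infinity>m\<in>{l+1..}. inner_term p l n a b (x + lam k) m)"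
  shows "(\<forall>i<p - l. \<forall>x>0. (deriv ^^ i) F field_differentiable at x) \<and>
         (\<forall>x\<in>X. \<forall>k\<in>list_indices N.
            inner_term p l n a b (x + lam k) summable_on {l+1..}) \<and>
         (\<forall>x\<in>X. ((\<lambda>k. 1 / (x + lam k) ^ (p + 1) * S x k)
            has_sum (deriv ^^ (p - l)) F x) (list_indices N)) \<and>
         (\<exists>B. \<forall>x\<in>X. \<forall>k\<in>list_indices N. \<bar>S x k\<bar> \<le> B)"
proof -
  note Delta0 = assms(10)
  from assms(3) have "has_genus f p" by (simp add: class_E_def)
  then obtain q g h N' c P where
    c0': "\<forall>k\<in>list_indices N'. c k \<noteq> 0" and
    summ: "(\<lambda>k. 1 / norm (c k) ^ (h + 1)) summable_on list_indices N'" and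
    P': "\<forall>z. (\<lambda>k. if k \<in> list_indices N' then weierstrass_factor h (z / c k) else 1) has_prod P z" and
    f': "\<forall>z. f z = z ^ q * exp (poly g z) * P z" and
    p: "p = max (degree g) h"
    unfolding has_genus_def by (elim exE conjE) (rule that)
  note c0 = c0'[rule_format] and P = P'[rule_format] and f = f'[rule_format]
  have f_real: "f (of_real x) \<in> \<real>" for x using assms(3) by (auto simp: class_E_def)
  have f_pos: "x > 0 \<Longrightarrow> Re (f (of_real x)) > 0" for x using assms(3) by (auto simp: class_E_def)
  have nz: "f 1 \<noteq> 0" using f_pos[of 1] by auto
  have lam: "\<And>k. k \<in> list_indices N \<Longrightarrow> lam k \<ge> 0" using assms(4) by (auto simp: lists_zeros_def)
  note mz = zero_lists_match[OF c0 summ P f nz assms(4)]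
  \<comment> \<open>The negative zeros of f are indexed by J, through the Hadamard product, and by I1, through lam.\<close>
  define J where "J = list_indices N'"
  define I0 where "I0 = {k \<in> list_indices N. lam k = 0}"
  define I1 where "I1 = {k \<in> list_indices N. lam k \<noteq> 0}"
  obtain s where s: "bij_betw s J I1" "\<And>k. k \<in> J \<Longrightarrow> c k = - of_real (lam (s k))"
    using mz(3) unfolding J_def I1_def by blast
  define \<mu> where "\<mu> k = lam (s k)" for k
  have \<mu>: "\<mu> k > 0" if "k \<in> J" for k
    using bij_betwE[OF s(1)] that lam[of "s k"] by (force simp: \<mu>_def I1_def)
  have c: "c k = - of_real (\<mu> k)" if "k \<in> J" for k using s(2)[OF that] by (simp add: \<mu>_def)
  have summ_\<mu>: "summable (\<lambda>k. if k \<in> J then 1 / \<mu> k ^ (h + 1) else 0)"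
  proof (rule summable_on_imp_summable)
    have "(\<lambda>k. if k \<in> J then 1 / \<mu> k ^ (h + 1) else 0) summable_on UNIV
       \<longleftrightarrow> (\<lambda>k. 1 / norm (c k) ^ (h + 1)) summable_on J"
      using \<mu> by (intro summable_on_cong_neutral) (auto simp: c norm_power dest!: \<mu>)
    then show "(\<lambda>k. if k \<in> J then 1 / \<mu> k ^ (h + 1) else 0) summable_on UNIV"
      using summ by (simp add: J_def)
  qed

  define M where "M = max (a n) (b n)"
  have a: "0 \<le> a j \<and> a j \<le> M" if "j \<in> {1..n}" for j
    using monotone_onD[OF assms(7), of 1 j] monotone_onD[OF assms(7), of j n] assms(5,6) that
    by (auto simp: M_def)
  have b: "0 \<le> b j \<and> b j \<le> M" if "j \<in> {1..n}" for j
    using monotone_onD[OF assms(9), of 1 j] monotone_onD[OF assms(9), of j n] assms(5,8) that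
    by (auto simp: M_def)
  have M0: "0 \<le> M" using a[of n] assms(5) by auto
  define d where "d = p - l"
  define G where "G = map_poly Re g"
  have dG: "degree G \<le> p" using map_poly_degree_leq[of Re g] p by (simp add: G_def)

  \<comment> \<open>L r is the r-th derivative of log f on the positive reals, FF r that of log W.\<close>
  define L where "L r x = real q * ln_deriv r x + poly ((pderiv ^^ r) G) x + log_product h J \<mu> r x" for r x
  have L: "(L r has_field_derivative L (Suc r) x) (at x)" if "x > 0" for r x
  proof -
    have "((pderiv ^^ Suc r) G) = pderiv ((pderiv ^^ r) G)" by simp
    then show ?thesis
      unfolding L_def[abs_def]
      by (simp only:) (intro DERIV_add DERIV_cmult poly_DERIV has_field_derivative_ln_deriv
        has_field_derivative_log_product \<mu> summ_\<mu> that)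
  qed
  have lnf: "ln (Re (f (of_real x))) = L 0 x" if "x > 0" for x
  proof -
    have "ln (Re (f (of_real x))) = real q * ln x + poly (map_poly Re g) x + log_product h J \<mu> 0 x"
      by (rule ln_hadamard_product[where f = f and c = c and h = h and P = "P (of_real x)",
            OF f[of "of_real x"] f_real[of x] f_pos[OF that] that])
         (use c \<mu> P[of "of_real x"] in \<open>auto simp: J_def\<close>)
    then show ?thesis by (simp add: L_def G_def)
  qed
  define FF where "FF r x = (\<Sum>j=1..n. L r (x + a j) - L r (x + b j))" for r x
  have FF: "(FF r has_field_derivative FF (Suc r) x) (at x)" if "x > 0" for r x
    unfolding FF_def[abs_def]
  proof (intro DERIV_sum DERIV_diff)
    fix j assume j: "j \<in> {1..n}"
    show "((\<lambda>x. L r (x + a j)) has_field_derivative L (Suc r) (x + a j)) (at x)"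
      using L[of "x + a j" r] a[OF j] that by (simp add: DERIV_shift)
    show "((\<lambda>x. L r (x + b j)) has_field_derivative L (Suc r) (x + b j)) (at x)"
      using L[of "x + b j" r] b[OF j] that by (simp add: DERIV_shift)
  qed
  have F: "F x = FF 0 x" if "x > 0" for x
  proof -
    have pa: "Re (f (of_real (x + a j))) > 0" if "j \<in> {1..n}" for j
      using f_pos[of "x + a j"] a[OF that] \<open>x > 0\<close> by simp
    have pb: "Re (f (of_real (x + b j))) > 0" if "j \<in> {1..n}" for j
      using f_pos[of "x + b j"] b[OF that] \<open>x > 0\<close> by simp
    have "F x = ln (\<Prod>k=1..n. Re (f (of_real (x + a k)))) - ln (\<Prod>k=1..n. Re (f (of_real (x + b k))))"
      unfolding F_def W_def by (intro ln_divide_pos prod_pos pa pb)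
    also have "\<dots> = (\<Sum>k=1..n. ln (Re (f (of_real (x + a k))))) - (\<Sum>k=1..n. ln (Re (f (of_real (x + b k)))))"
    proof (intro arg_cong2[where f = "(-)"] ln_prod)
      show "Re (f (of_real (x + a k))) \<noteq> 0" "Re (f (of_real (x + b k))) \<noteq> 0" if "k \<in> {1..n}" for k
        using pa[OF that] pb[OF that] by simp_all
    qed auto
    also have "\<dots> = (\<Sum>k=1..n. ln (Re (f (of_real (x + a k)))) - ln (Re (f (of_real (x + b k)))))"
      by (simp add: sum_subtractf)
    also have "\<dots> = FF 0 x"
      unfolding FF_def using a b \<open>x > 0\<close>
      by (intro sum.cong refl arg_cong2[where f = "(-)"] lnf add_pos_nonneg) auto
    finally show ?thesis .
  qed
  note hd = higher_deriv_eqI[of F FF, OF F FF]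

  \<comment> \<open>D t is the contribution of the zero - lam k to the derivative of order d of log W at x,
     with t = x + lam k.\<close>
  define D where "D t = (\<Sum>j=1..n. ln_deriv d (t + a j) - ln_deriv d (t + b j))" for t
  have poly0: "(\<Sum>j=1..n. poly ((pderiv ^^ d) Q) (x + a j) - poly ((pderiv ^^ d) Q) (x + b j)) = 0"
    if "degree Q \<le> p" for Q :: "real poly" and x
    using that assms(2) Delta0
    by (intro shift_difference_poly[of _ l]) (simp_all add: degree_higher_pderiv d_def)
  have FFd: "(\<lambda>k. if k \<in> J then D (x + \<mu> k) else 0) sums (FF d x - real q * D x)" if x: "x > 0" for x
  proof -
    let ?u = "\<lambda>x k. if k \<in> J then log_factor h d (\<mu> k) x else 0"
    have us: "(\<lambda>k. ?u y k) sums log_product h J \<mu> d y" if "y > 0" for y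
      unfolding log_product_def by (intro summable_sums summable_log_product \<mu> summ_\<mu> that)
    have "(\<lambda>k. \<Sum>j=1..n. ?u (x + a j) k - ?u (x + b j) k)
      sums (\<Sum>j=1..n. log_product h J \<mu> d (x + a j) - log_product h J \<mu> d (x + b j))"
      using a b x by (intro sums_sum sums_diff us add_pos_nonneg) auto
    moreover have "(\<Sum>j=1..n. ?u (x + a j) k - ?u (x + b j) k) = (if k \<in> J then D (x + \<mu> k) else 0)" for k
    proof (cases "k \<in> J")
      case True
      let ?T = "(pderiv ^^ d) (taylor_ln h (\<mu> k))"
      have "(\<Sum>j=1..n. ?u (x + a j) k - ?u (x + b j) k)
         = (\<Sum>j=1..n. (ln_deriv d (x + \<mu> k + a j) - ln_deriv d (x + \<mu> k + b j))
              - (poly ?T (x + a j) - poly ?T (x + b j)))"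
        using True by (intro sum.cong) (simp_all add: log_factor_def algebra_simps)
      also have "\<dots> = D (x + \<mu> k) - (\<Sum>j=1..n. poly ?T (x + a j) - poly ?T (x + b j))"
        unfolding D_def by (rule sum_subtractf)
      also have "(\<Sum>j=1..n. poly ?T (x + a j) - poly ?T (x + b j)) = 0"
        using degree_taylor_ln[of h "\<mu> k"] p by (intro poly0) auto
      finally show ?thesis using True by simp
    qed simp
    moreover have "(\<Sum>j=1..n. log_product h J \<mu> d (x + a j) - log_product h J \<mu> d (x + b j))
      = FF d x - real q * D x"
    proof -
      have "FF d x = (\<Sum>j=1..n. real q * (ln_deriv d (x + a j) - ln_deriv d (x + b j))
          + (poly ((pderiv ^^ d) G) (x + a j) - poly ((pderiv ^^ d) G) (x + b j))
          + (log_product h J \<mu> d (x + a j) - log_product h J \<mu> d (x + b j)))"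
        unfolding FF_def L_def by (intro sum.cong) (simp_all add: algebra_simps)
      then show ?thesis
        using poly0[OF dG, of x] by (simp add: sum.distrib sum_distrib_left[symmetric] D_def)
    qed
    ultimately show ?thesis by simp
  qed

  define B where "B = (\<Sum>m. 2 * real n * (2 * M) ^ (l + 1) * \<bar>C p m l * (1 / 2) ^ m\<bar>)"
  have ex: "(inner_term p l n a b t has_sum t ^ (p + 1) * D t) {l+1..}"
    "\<bar>\<Sum>\<^sub>\<infinity>m\<in>{l+1..}. inner_term p l n a b t m\<bar> \<le> B" if "0 < t" "2 * M \<le> t" for t
    unfolding D_def d_def B_def
    using shift_difference_expansion[OF assms(2) Delta0 a b M0 that] by blast+
  have X: "0 < x + lam k \<and> 2 * M \<le> x + lam k" if "x \<in> X" "k \<in> list_indices N" for x k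
    using that lam[of k] by (auto simp: X_def M_def)
  have S: "S x k = (x + lam k) ^ (p + 1) * D (x + lam k)" if "x \<in> X" "k \<in> list_indices N" for x k
    unfolding S_def using X[OF that] by (intro infsumI ex) auto
  have Sb: "\<bar>S x k\<bar> \<le> B" if "x \<in> X" "k \<in> list_indices N" for x k
    unfolding S_def using X[OF that] by (intro ex) auto
  have SD: "1 / (x + lam k) ^ (p + 1) * S x k = D (x + lam k)" if "x \<in> X" "k \<in> list_indices N" for x k
    using S[OF that] X[OF that] by simp

  have "((\<lambda>k. D (x + lam k)) has_sum FF d x) (list_indices N)" if x: "x \<in> X" for x
  proof -
    have x0: "x > 0" "2 * M \<le> x" using x by (auto simp: X_def M_def)
    let ?v = "\<lambda>k. if k \<in> J then D (x + \<mu> k) else 0"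
  \<comment> \<open>The derivative is so far a sum in the order of the list c; absolute convergence allows
     the zeros to be listed by lam instead.\<close>
    have "summable (\<lambda>k. norm (?v k))"
    proof (rule summable_comparison_test')
      show "summable (\<lambda>k. B / x ^ (p - h) * (if k \<in> J then 1 / \<mu> k ^ (h + 1) else 0))"
        by (rule summable_mult[OF summ_\<mu>])
      show "norm (norm (?v k)) \<le> B / x ^ (p - h) * (if k \<in> J then 1 / \<mu> k ^ (h + 1) else 0)" for k
      proof (cases "k \<in> J")
        case True
        then have sk: "s k \<in> list_indices N" using bij_betwE[OF s(1)] by (auto simp: I1_def)
        have t: "x + \<mu> k > 0" using x0 \<mu>[OF True] by simp
        have B0: "0 \<le> B" using Sb[OF x sk] by linarith
        have "\<bar>D (x + \<mu> k)\<bar> = \<bar>S x (s k)\<bar> / (x + \<mu> k) ^ (p + 1)"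
          using S[OF x sk] t by (simp add: \<mu>_def abs_mult)
        also have "\<dots> \<le> B / (x + \<mu> k) ^ (p + 1)"
          using t Sb[OF x sk] by (intro divide_right_mono) auto
        \<comment> \<open>The genus p may exceed h; the excess p - h of the exponent is absorbed by powers of x.\<close>
        also have "\<dots> \<le> B / (x ^ (p - h) * \<mu> k ^ (h + 1))"
        proof (intro divide_left_mono B0)
          have "x ^ (p - h) * \<mu> k ^ (h + 1) \<le> (x + \<mu> k) ^ (p - h) * (x + \<mu> k) ^ (h + 1)"
            using x0 \<mu>[OF True] by (intro mult_mono power_mono) auto
          also have "\<dots> = (x + \<mu> k) ^ (p + 1)" using p by (simp flip: power_add)
          finally show "x ^ (p - h) * \<mu> k ^ (h + 1) \<le> (x + \<mu> k) ^ (p + 1)" .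
        qed (use x0 \<mu>[OF True] t in auto)
        finally show ?thesis using True by simp
      qed simp
    qed
    from norm_summable_imp_has_sum[OF this FFd[OF x0(1)]]
    have "(?v has_sum (FF d x - real q * D x)) UNIV" .
    also have "?this \<longleftrightarrow> ((\<lambda>k. D (x + lam (s k))) has_sum (FF d x - real q * D x)) J"
      by (rule has_sum_cong_neutral) (auto simp: \<mu>_def)
    also have "\<dots> \<longleftrightarrow> ((\<lambda>k. D (x + lam k)) has_sum (FF d x - real q * D x)) I1"
      by (rule has_sum_reindex_bij_betw[OF s(1)])
    finally have h1: "((\<lambda>k. D (x + lam k)) has_sum (FF d x - real q * D x)) I1" .
    \<comment> \<open>The factor z^q accounts for the q indices with lam k = 0.\<close>
    have "((\<lambda>k. D (x + lam k)) has_sum (\<Sum>k\<in>I0. D (x + lam k))) I0"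
      using mz(1) by (intro has_sum_finite) (simp add: I0_def)
    also have "(\<Sum>k\<in>I0. D (x + lam k)) = real q * D x"
      using mz(2) by (simp add: I0_def)
    finally have "((\<lambda>k. D (x + lam k)) has_sum (real q * D x + (FF d x - real q * D x))) (I0 \<union> I1)"
      using h1 by (rule has_sum_Un_disjoint) (auto simp: I0_def I1_def)
    also have "I0 \<union> I1 = list_indices N" by (auto simp: I0_def I1_def)
    finally show ?thesis by simp
  qed
  then have main: "((\<lambda>k. 1 / (x + lam k) ^ (p + 1) * S x k) has_sum (deriv ^^ (p - l)) F x) (list_indices N)"
    if "x \<in> X" for x
    using that hd(1)[of x d] by (subst has_sum_cong[OF SD[OF that]]) (auto simp: X_def d_def)
  show ?thesis
  proof (intro conjI ballI allI impI exI)
    fix i and x :: real assume "x > 0"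
    then show "(deriv ^^ i) F field_differentiable at x"
      using hd(2) field_differentiable_def by blast
  next
    fix x k assume "x \<in> X" "k \<in> list_indices N"
    then show "inner_term p l n a b (x + lam k) summable_on {l+1..}"
      using ex(1) X has_sum_imp_summable by blast
  qed (use main Sb in auto)
qed

end
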